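(* For $\Re x>0$, $$\Psi(x+1)=\ln x+\sum_{k=1}^{\infty}\Phi(-1,1,2^kx+1)=\ln x+\sum_{k=1}^{\infty}\sum_{j=1}^{\infty}\frac{(j-1)!}{2^j\,(2^kx+1)_j}.$$
   Context: $\Psi=\Gamma'/\Gamma$ is the digamma function; $\Phi(z,s,a)=\int$-continued Lerch transcendent, $\Phi(z,s,a)=\sum_{n\ge0}z^n/(n+a)^s$ (so $\Phi(-1,1,a)=\sum_{n\ge0}(-1)^n/(n+a)=\int_0^\infty\frac{\mathrm{e}^{-aq}}{1+\mathrm{e}^{-q}}dq$ for $\Re a>0$); $(z)_j=z(z+1)\cdots(z+j-1)$ is the rising factorial; $\ln$ is the principal branch. *)

theory Defs
  imports "HOL-Analysis.Analysis"
begin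

text \<open>
  The Lerch transcendent given by its series, with principal powers (in \<open>suminf\<close>, summation
  is in the order of the index, so conditionally convergent series such as
  \<open>z = -1\<close>, \<open>s = 1\<close> are covered).  Where the series diverges the value is
  meaningless: no analytic continuation in \<open>z\<close> is performed.
\<close>

definition lerch_Phi :: "complex \<Rightarrow> complex \<Rightarrow> complex \<Rightarrow> complex" where
  "lerch_Phi z s a = (\<Sum>n. z ^ n / (of_nat n + a) powr s)"

lemma lerch_Phi_minus1_1_sums:
  assumes "Re a > 0"
  shows "(\<lambda>n. (-1) ^ n / (of_nat n + a)) sums lerch_Phi (-1) 1 a"
proof -
  define f where "f = (\<lambda>n. (-1) ^ n / (of_nat n + a))"
  have nz: "of_nat n + a \<noteq> 0" for n
  proof -
    have "Re (of_nat n + a) > 0" using assms by simp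
    thus ?thesis by force
  qed
  have ge: "norm (of_nat n + a) \<ge> real n" for n
    using complex_Re_le_cmod[of "of_nat n + a"] assms by simp
  have lim: "f \<longlonglongrightarrow> 0"
  proof (rule Lim_null_comparison)
    show "\<forall>\<^sub>F n in sequentially. norm (f n) \<le> inverse (real n)"
      using eventually_gt_at_top[of 0]
    proof eventually_elim
      case (elim n)
      thus ?case using ge[of n]
        by (simp add: f_def norm_divide norm_power inverse_eq_divide frac_le)
    qed
  qed (rule lim_inverse_n)
  have "summable (\<lambda>n. f (Suc n) + f n)"
  proof (rule summable_comparison_test_ev)
    show "summable (\<lambda>n. inverse (real n ^ 2))"
      by (rule inverse_power_summable) simp
    show "\<forall>\<^sub>F n in sequentially. norm (f (Suc n) + f n) \<le> inverse (real n ^ 2)"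
      using eventually_gt_at_top[of 0]
    proof eventually_elim
      case (elim n)
      have "f (Suc n) + f n = (-1) ^ n / ((of_nat n + a) * (of_nat (Suc n) + a))"
        using nz[of n] nz[of "Suc n"] unfolding f_def by (simp add: divide_simps) (simp add: algebra_simps)
      hence "norm (f (Suc n) + f n) =
               1 / (norm (of_nat n + a) * norm (of_nat (Suc n) + a))"
        by (simp only: norm_divide norm_mult norm_power norm_minus_cancel norm_one power_one)
      also have "\<dots> \<le> 1 / (real n * real n)"
        using ge[of n] ge[of "Suc n"] elim by (intro divide_left_mono mult_mono mult_pos_pos) auto
      finally show ?case by (simp add: inverse_eq_divide power2_eq_square)
    qed
  qed
  from summable_diff[OF this telescope_summable[OF lim]]
  have "summable (\<lambda>n. 2 * f n)" by simp
  hence "summable f" by (subst (asm) summable_cmult_iff) simp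
  moreover have "lerch_Phi (-1) 1 a = suminf f"
    using nz by (simp add: lerch_Phi_def f_def)
  ultimately show ?thesis by (simp add: summable_sums f_def)
qed

end

theory Submission
  imports Defs
begin

text \<open>
  Pairing consecutive terms of the alternating series gives
  \<open>\<Phi>(-1,1,2y+1) = \<Psi>(y+1) - \<Psi>(2y+1) + ln 2\<close>, so for \<open>y = 2\<^sup>k x\<close> the outer series
  telescopes in \<open>\<Psi>(2\<^sup>k x + 1) - Ln (2\<^sup>k x)\<close>, which tends to \<open>0\<close> because
  \<open>\<bar>\<Psi>(z+1) - Ln z\<bar> \<le> 1 / Re z\<close>.  The inner series is the Euler transform of
  \<open>\<Sum>n. (-1)\<^sup>n / (n+a)\<close>: the \<open>j\<close>-th difference (with sign \<open>(-1)\<^sup>j\<close>) of \<open>1/(n+a)\<close> is \<open>j! / (n+a)\<^bsub>j+1\<^esub>\<close>.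
\<close>

section \<open>Comparing digamma with the logarithm\<close>

lemma Digamma_diff_LIMSEQ_Ln:
  fixes z :: complex
  assumes "Re z > 0"
  shows "(\<lambda>m. Ln (z + of_nat m) - (\<Sum>n<m. 1 / (z + of_nat n + 1))) \<longlonglongrightarrow> Digamma (z + 1)"
proof -
  have z1: "z + 1 \<noteq> 0"
    using assms by (auto simp: complex_eq_iff)
  \<comment> \<open>Passing from ln m to \<open>Ln (z + of_nat m)\<close> costs
    \<open>Ln (z / of_nat m + 1)\<close>, which tends to 0. In the new form, subtracting
    \<open>Ln z\<close> leaves a sum of increments of \<open>Ln\<close>.\<close>
  have "(\<lambda>m. z / of_nat m + 1) \<longlonglongrightarrow> 0 + 1"
    by (intro tendsto_intros lim_const_over_n)
  hence "(\<lambda>m. Ln (z / of_nat m + 1)) \<longlonglongrightarrow> Ln 1"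
    by (intro tendsto_Ln) auto
  with Digamma_LIMSEQ[OF z1]
  have lim: "(\<lambda>m. (of_real (ln (real m)) - (\<Sum>n<m. inverse (z + 1 + of_nat n)))
                  + Ln (z / of_nat m + 1)) \<longlonglongrightarrow> Digamma (z + 1)"
    by (auto dest: tendsto_add)
  have "\<forall>\<^sub>F m in sequentially.
          (of_real (ln (real m)) - (\<Sum>n<m. inverse (z + 1 + of_nat n))) + Ln (z / of_nat m + 1)
          = Ln (z + of_nat m) - (\<Sum>n<m. 1 / (z + of_nat n + 1))"
    using eventually_gt_at_top[of 0]
  proof eventually_elim
    case (elim m)
    have "Re (z / of_nat m + 1) > 0"
      using assms elim by (simp add: add_pos_pos)
    hence "z / of_nat m + 1 \<noteq> 0" by force
    hence "Ln (of_real (real m) * (z / of_nat m + 1)) = of_real (ln (real m)) + Ln (z / of_nat m + 1)"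
      using elim Ln_times_of_nat[of m "z / of_nat m + 1"] by simp
    moreover have "of_real (real m) * (z / of_nat m + 1) = z + of_nat m"
      using elim by (simp add: field_simps)
    ultimately show ?case
      by (simp add: inverse_eq_divide add_ac)
  qed
  with lim show ?thesis
    by (rule Lim_transform_eventually)
qed

text \<open>Mean value bound on the segment from w to w + 1: subtracting s / (w + 1) from Ln s makes
  the derivative vanish at the right end. The bound is a difference so that it telescopes along w =
  z + n.\<close>

lemma norm_Ln_increment_le:
  fixes w :: complex
  assumes "Re w > 0"
  shows "norm (Ln (w + 1) - Ln w - 1 / (w + 1)) \<le> 1 / Re w - 1 / (Re w + 1)"
proof -
  define r where "r = Re w"
  have r: "r > 0" using assms by (simp add: r_def)
  let ?S = "closed_segment w (w + 1)"
  let ?f = "\<lambda>s. Ln s - s / (w + 1)"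
  have S: "\<exists>t. 0 \<le> t \<and> t \<le> 1 \<and> s = w + of_real t" if "s \<in> ?S" for s
    using that by (auto simp: closed_segment_def scaleR_conv_of_real algebra_simps)
  have "norm (?f (w + 1) - ?f w) \<le> (1 / (r * (r + 1))) * norm (w + 1 - w)"
  proof (rule field_differentiable_bound)
    fix s assume "s \<in> ?S"
    then obtain t where t: "0 \<le> t" "t \<le> 1" "s = w + of_real t" using S by blast
    have Res: "Re s \<ge> r" using t by (simp add: r_def)
    have s: "s \<noteq> 0" "s \<notin> \<real>\<^sub>\<le>\<^sub>0" using Res r by (auto simp: complex_nonpos_Reals_iff)
    have w1: "w + 1 \<noteq> 0" using r by (auto simp: r_def complex_eq_iff)
    show "(?f has_field_derivative (1 / s - 1 / (w + 1))) (at s within ?S)"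
      using s w1 by (auto intro!: derivative_eq_intros simp: inverse_eq_divide)
    have "1 / s - 1 / (w + 1) = of_real (1 - t) / (s * (w + 1))"
      using s w1 t(3) by (simp add: field_simps)
    also have "norm \<dots> = (1 - t) / (norm s * norm (w + 1))"
      using t by (simp add: norm_divide norm_mult del: of_real_diff)
    also have "\<dots> \<le> 1 / (r * (r + 1))"
      using r t Res complex_Re_le_cmod[of s] complex_Re_le_cmod[of "w + 1"]
      by (intro frac_le mult_mono) (auto simp: r_def)
    finally show "norm (1 / s - 1 / (w + 1)) \<le> 1 / (r * (r + 1))" .
  qed auto
  moreover have "(w + 1) / (w + 1) - w / (w + 1) = 1 / (w + 1)"
    by (simp only: diff_divide_distrib[symmetric]) simp
  hence "?f (w + 1) - ?f w = Ln (w + 1) - Ln w - 1 / (w + 1)"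
    by algebra
  moreover have "1 / (r * (r + 1)) = 1 / r - 1 / (r + 1)"
    using r by (simp add: field_simps)
  ultimately show ?thesis
    by (simp only: r_def add_diff_cancel_left' norm_one mult_1_right)
qed

text \<open>The increment bounds telescope to 1 / Re z - 1 / (Re z + m), so 1 / Re z bounds every
  approximant and hence the limit.\<close>

lemma norm_Digamma_minus_Ln_le:
  fixes z :: complex
  assumes "Re z > 0"
  shows "norm (Digamma (z + 1) - Ln z) \<le> 1 / Re z"
proof (rule Lim_norm_ubound)
  show "(\<lambda>m. Ln (z + of_nat m) - (\<Sum>n<m. 1 / (z + of_nat n + 1)) - Ln z)
          \<longlonglongrightarrow> Digamma (z + 1) - Ln z"
    by (intro tendsto_diff Digamma_diff_LIMSEQ_Ln assms tendsto_const)
  have "norm (Ln (z + of_nat m) - (\<Sum>n<m. 1 / (z + of_nat n + 1)) - Ln z) \<le> 1 / Re z" for m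
  proof -
    let ?d = "\<lambda>n. Ln (z + of_nat n + 1) - Ln (z + of_nat n) - 1 / (z + of_nat n + 1)"
    have "Ln (z + of_nat m) - (\<Sum>n<m. 1 / (z + of_nat n + 1)) - Ln z = (\<Sum>n<m. ?d n)"
      by (induction m) (simp_all add: algebra_simps)
    also have "norm \<dots> \<le> (\<Sum>n<m. 1 / (Re z + n) - 1 / (Re z + Suc n))"
      using assms norm_Ln_increment_le[of "z + of_nat n" for n]
      by (intro sum_norm_le) (simp add: add_ac)
    also have "\<dots> = 1 / Re z - 1 / (Re z + m)"
      by (induction m) auto
    also have "\<dots> \<le> 1 / Re z"
      using assms by simp
    finally show ?thesis .
  qed
  thus "\<forall>\<^sub>F m in sequentially.
          norm (Ln (z + of_nat m) - (\<Sum>n<m. 1 / (z + of_nat n + 1)) - Ln z) \<le> 1 / Re z"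
    by simp
qed simp

section \<open>The outer series\<close>

text \<open>Convergence is known, so even partial sums suffice. Since 1 / (y + 1 + k) = 2 / (2y + 1
  + (2k + 1)), subtracting these terms flips the sign of the odd-indexed ones; ln 2 compensates ln
  (2m) - ln m.\<close>

lemma lerch_Phi_minus1_1_eq_Digamma:
  fixes y :: complex
  assumes "Re y > 0"
  shows "lerch_Phi (-1) 1 (2 * y + 1) = Digamma (y + 1) - Digamma (2 * y + 1) + of_real (ln 2)"
proof (rule LIMSEQ_unique)
  have nz: "y + 1 \<noteq> 0" "2 * y + 1 \<noteq> 0"
    using assms by (auto simp: complex_eq_iff)
  have double: "filterlim (\<lambda>m::nat. 2 * m) at_top sequentially"
    by (rule filterlim_subseq) (simp add: strict_mono_def)
  have "(\<lambda>n. (-1) ^ n / (of_nat n + (2 * y + 1))) sums lerch_Phi (-1) 1 (2 * y + 1)"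
    by (rule lerch_Phi_minus1_1_sums) (use assms in simp)
  thus "(\<lambda>m. \<Sum>n<2*m. (-1) ^ n / (of_nat n + (2 * y + 1)))
          \<longlonglongrightarrow> lerch_Phi (-1) 1 (2 * y + 1)"
    unfolding sums_def by (rule filterlim_compose[OF _ double])
  have "(\<lambda>m. (of_real (ln (real m)) - (\<Sum>n<m. inverse (y + 1 + of_nat n)))
           - (of_real (ln (real (2 * m))) - (\<Sum>n<2*m. inverse (2 * y + 1 + of_nat n)))
           + of_real (ln 2)) \<longlonglongrightarrow> Digamma (y + 1) - Digamma (2 * y + 1) + of_real (ln 2)"
    by (intro tendsto_intros Digamma_LIMSEQ nz
          filterlim_compose[OF Digamma_LIMSEQ[OF nz(2)] double])
  moreover have "\<forall>\<^sub>F m in sequentially.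
      (of_real (ln (real m)) - (\<Sum>n<m. inverse (y + 1 + of_nat n)))
           - (of_real (ln (real (2 * m))) - (\<Sum>n<2*m. inverse (2 * y + 1 + of_nat n)))
           + of_real (ln 2) = (\<Sum>n<2*m. (-1) ^ n / (of_nat n + (2 * y + 1)))"
    using eventually_gt_at_top[of 0]
  proof eventually_elim
    case (elim m)
    have "(\<Sum>n<2*m. inverse (2 * y + 1 + of_nat n)) - (\<Sum>n<m. inverse (y + 1 + of_nat n))
            = (\<Sum>n<2*m. (-1) ^ n / (of_nat n + (2 * y + 1)))"
    proof (induction m)
      case (Suc m)
      \<comment> \<open>Cancelling the 2 is stated separately, and then in the normal form that
        \<open>algebra_simps\<close> gives to the new terms.\<close>
      have "2 / (2 * (1 + (y + of_nat m))) = 1 / (1 + (y + of_nat m))"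
        using mult_divide_mult_cancel_left[of 2 1 "1 + (y + of_nat m)"] by simp
      hence "2 / (2 + (y * 2 + of_nat m * 2)) = 1 / (1 + (y + of_nat m))"
        by (simp add: algebra_simps)
      thus ?case
        using Suc.IH by (simp add: inverse_eq_divide algebra_simps)
    qed simp
    with elim show ?case
      by (simp add: ln_mult algebra_simps)
  qed
  ultimately show "(\<lambda>m. \<Sum>n<2*m. (-1) ^ n / (of_nat n + (2 * y + 1)))
      \<longlonglongrightarrow> Digamma (y + 1) - Digamma (2 * y + 1) + of_real (ln 2)"
    by (rule Lim_transform_eventually)
qed

lemma Digamma_eq_Ln_plus_lerch_sums:
  fixes x :: complex
  assumes "Re x > 0"
  shows "(\<lambda>k. lerch_Phi (-1) 1 (2 ^ Suc k * x + 1)) sums (Digamma (x + 1) - Ln x)"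
proof -
  define g where "g k = Digamma (2 ^ k * x + 1) - Ln (2 ^ k * x)" for k
  have Re: "Re (2 ^ k * x) = 2 ^ k * Re x" for k
    by (induction k) auto
  have "lerch_Phi (-1) 1 (2 ^ Suc k * x + 1) = g k - g (Suc k)" for k
  proof -
    have x: "Re (2 ^ k * x) > 0" using assms by (simp add: Re)
    hence "2 ^ k * x \<noteq> 0" by auto
    \<comment> \<open>A positive real factor does not change the argument, so the logarithm splits
      without a branch correction; its ln 2 absorbs the one in the digamma identity.\<close>
    hence "Ln (of_real 2 * (2 ^ k * x)) = of_real (ln 2) + Ln (2 ^ k * x)"
      by (subst Ln_times_of_real) (simp_all only: Ln_of_real zero_less_numeral not_False_eq_True)
    thus ?thesis
      using lerch_Phi_minus1_1_eq_Digamma[OF x] by (simp add: g_def mult.assoc)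
  qed
  moreover have "g \<longlonglongrightarrow> 0"
  proof (rule Lim_null_comparison)
    show "\<forall>\<^sub>F k in sequentially. norm (g k) \<le> (1 / 2) ^ k * (1 / Re x)"
      using norm_Digamma_minus_Ln_le[of "2 ^ k * x" for k] assms
      by (simp add: g_def Re power_one_over divide_simps)
    show "(\<lambda>k. (1 / 2) ^ k * (1 / Re x)) \<longlonglongrightarrow> 0"
      by (intro tendsto_mult_left_zero LIMSEQ_power_zero) simp
  qed
  ultimately show ?thesis
    using telescope_sums'[of g 0] by (simp add: g_def)
qed

section \<open>The Euler transform\<close>

text \<open>All three denominators share P = \<open>pochhammer (a + 1) j\<close>: they are a P, P (a
  + j + 1) and a P (a + j + 1). The numerator becomes j! ((a + j + 1) - a) = (j + 1)!.\<close>

lemma pochhammer_quotient_diff: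
  fixes a :: complex
  assumes "Re a > 0"
  shows "fact j / pochhammer a (Suc j) - fact j / pochhammer (a + 1) (Suc j)
           = fact (Suc j) / pochhammer a (Suc (Suc j))"
proof -
  have nz: "a + of_nat n \<noteq> 0" for n
    using assms by (auto simp: complex_eq_iff)
  have "pochhammer (a + 1) j \<noteq> 0"
    using nz[of "Suc n" for n] by (auto simp: pochhammer_eq_0_iff eq_neg_iff_add_eq_0 add_ac)
  moreover have "pochhammer a (Suc j) = a * pochhammer (a + 1) j"
    by (rule pochhammer_rec)
  moreover have "pochhammer (a + 1) (Suc j) = pochhammer (a + 1) j * (a + of_nat (Suc j))"
    by (simp add: pochhammer_Suc add_ac)
  moreover have "pochhammer a (Suc (Suc j)) = a * (pochhammer (a + 1) j * (a + of_nat (Suc j)))"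
    by (subst pochhammer_rec) (simp add: pochhammer_Suc add_ac)
  ultimately show ?thesis
    using nz[of 0] nz[of "Suc j"]
    by (simp add: divide_simps fact_Suc del: of_nat_Suc) (simp add: algebra_simps)
qed

text \<open>The recursion S (j + 1) = 2 S j - t j 0 peels off one transformed term per step. The
  remainder S m / 2 ^ m vanishes because S m is bounded uniformly for m > 0.\<close>

lemma lerch_Phi_minus1_1_Euler_transform:
  fixes a :: complex
  assumes "Re a > 0"
  shows "(\<lambda>j. fact (Suc j - 1) / (2 ^ Suc j * pochhammer a (Suc j))) sums lerch_Phi (-1) 1 a"
proof -
  define t where "t j n = fact j / pochhammer (a + of_nat n) (Suc j)" for j n
  \<comment> \<open>The alternating sum of the \<open>j\<close>-th differences; \<open>S 0\<close> is the sum to be transformed, and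
    \<open>S j / 2 ^ j\<close> is the remainder after \<open>j\<close> terms of the transformed series.\<close>
  define S where "S j = (\<Sum>n. (-1) ^ n * t j n)" for j
  have Re: "Re (a + of_nat n) > 0" for n
    using assms by simp
  have t_Suc: "t (Suc j) n = t j n - t j (Suc n)" for j n
    using pochhammer_quotient_diff[OF Re[of n], of j] by (simp add: t_def add_ac)
  \<comment> \<open>The ratio of the two terms is (j + 1) / (a + n + j + 1), of modulus at most 1.
    So \<open>t 1\<close>, of order 1 / n^2, dominates all later levels.\<close>
  have t_le: "norm (t (Suc j) n) \<le> norm (t j n)" for j n
  proof -
    have "t (Suc j) n = t j n * (of_nat (Suc j) / (a + of_nat n + of_nat (Suc j)))"
      by (simp add: t_def pochhammer_Suc[of _ "Suc j"] fact_Suc)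
    also have "norm \<dots> = norm (t j n) * (real (Suc j) / norm (a + of_nat n + of_nat (Suc j)))"
      by (simp only: norm_mult norm_divide norm_of_nat)
    also have "\<dots> \<le> norm (t j n) * 1"
    proof (intro mult_left_mono)
      have "real (Suc j) \<le> norm (a + of_nat n + of_nat (Suc j))"
        using complex_Re_le_cmod[of "a + of_nat n + of_nat (Suc j)"] assms by simp
      thus "real (Suc j) / norm (a + of_nat n + of_nat (Suc j)) \<le> 1"
        by (intro divide_le_eq_1[THEN iffD2]) auto
    qed auto
    finally show ?thesis by simp
  qed
  have t_le1: "norm (t (Suc j) n) \<le> norm (t 1 n)" for j n
  proof (induction j)
    case (Suc j)
    show ?case by (rule order_trans[OF t_le Suc.IH])
  qed simp
  have summ1: "summable (\<lambda>n. norm (t 1 n))"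
  proof (rule summable_comparison_test_ev)
    show "summable (\<lambda>n. inverse (real n ^ 2))"
      by (rule inverse_power_summable) simp
    show "\<forall>\<^sub>F n in sequentially. norm (norm (t 1 n)) \<le> inverse (real n ^ 2)"
      using eventually_gt_at_top[of 0]
    proof eventually_elim
      case (elim n)
      have "norm (t 1 n) = 1 / (norm (a + of_nat n) * norm (a + of_nat n + 1))"
        by (simp add: t_def pochhammer_Suc norm_divide norm_mult)
      also have "\<dots> \<le> 1 / (real n * real n)"
        using complex_Re_le_cmod[of "a + of_nat n"] complex_Re_le_cmod[of "a + of_nat n + 1"]
          elim assms by (intro frac_le mult_mono) auto
      finally show ?case by (simp add: power2_eq_square inverse_eq_divide)
    qed
  qed
  have summ_norm: "summable (\<lambda>n. norm ((-1) ^ n * t (Suc j) n))" for j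
    by (rule summable_comparison_test[OF _ summ1])
       (use t_le1 in \<open>auto simp: norm_mult norm_power\<close>)
  have sums_0: "(\<lambda>n. (-1) ^ n * t 0 n) sums lerch_Phi (-1) 1 a"
    using lerch_Phi_minus1_1_sums[OF assms] by (simp add: t_def add_ac)
  \<comment> \<open>Level 0 converges only conditionally and is handled by \<open>sums_0\<close>;
    the later levels converge absolutely.\<close>
  have sums_S: "(\<lambda>n. (-1) ^ n * t j n) sums S j" for j
  proof (cases j)
    case 0
    thus ?thesis using sums_0 by (simp add: S_def sums_iff)
  next
    case (Suc i)
    thus ?thesis unfolding S_def
      using summable_norm_cancel[OF summ_norm[of i]] by (simp add: summable_sums)
  qed
  have S_0: "S 0 = lerch_Phi (-1) 1 a"
    using sums_0 by (simp add: S_def sums_iff)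
  have S_Suc: "S (Suc j) = 2 * S j - t j 0" for j
  proof -
    \<comment> \<open>Dropping the first term shifts the index and flips the sign, so adding the
      original series produces the differences in \<open>t_Suc\<close>.\<close>
    have "(\<lambda>n. (-1) ^ Suc n * t j (Suc n)) sums (S j - t j 0)"
      using sums_S[of j] by (subst sums_Suc_iff) simp
    from sums_add[OF sums_S[of j] this]
    have "(\<lambda>n. (-1) ^ n * t (Suc j) n) sums (2 * S j - t j 0)"
      by (simp add: t_Suc algebra_simps)
    thus ?thesis using sums_S[of "Suc j"] by (rule sums_unique2[symmetric])
  qed
  have partial: "(\<Sum>j<m. fact (Suc j - 1) / (2 ^ Suc j * pochhammer a (Suc j)))
                   = lerch_Phi (-1) 1 a - S m / 2 ^ m" for m
  proof (induction m)
    case (Suc m)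
    have "fact (Suc m - 1) / (2 ^ Suc m * pochhammer a (Suc m)) = t m 0 / 2 ^ Suc m"
      by (simp add: t_def)
    thus ?case
      using Suc.IH by (simp add: S_Suc diff_divide_distrib)
  qed (simp add: S_0)
  have S_le: "norm (S (Suc j)) \<le> (\<Sum>n. norm (t 1 n))" for j
  proof -
    have "norm (S (Suc j)) \<le> (\<Sum>n. norm ((-1) ^ n * t (Suc j) n))"
      unfolding S_def by (rule summable_norm[OF summ_norm])
    also have "\<dots> \<le> (\<Sum>n. norm (t 1 n))"
      by (intro suminf_le summ_norm summ1) (use t_le1 in \<open>simp add: norm_mult norm_power\<close>)
    finally show ?thesis .
  qed
  have "(\<lambda>m. S m / 2 ^ m) \<longlonglongrightarrow> 0"
  proof (rule Lim_null_comparison)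
    show "\<forall>\<^sub>F m in sequentially. norm (S m / 2 ^ m) \<le> (\<Sum>n. norm (t 1 n)) * (1 / 2) ^ m"
      using eventually_gt_at_top[of 0]
    proof eventually_elim
      case (elim m)
      hence "norm (S m) \<le> (\<Sum>n. norm (t 1 n))" using S_le[of "m - 1"] by simp
      thus ?case by (simp add: norm_divide norm_power power_one_over divide_right_mono)
    qed
    show "(\<lambda>m. (\<Sum>n. norm (t 1 n)) * (1 / 2) ^ m) \<longlonglongrightarrow> 0"
      by (intro tendsto_mult_right_zero LIMSEQ_power_zero) simp
  qed
  from tendsto_diff[OF tendsto_const[of "lerch_Phi (-1) 1 a"] this] show ?thesis
    unfolding sums_def partial by simp
qed

text \<open>Summability accompanies each identity because \<open>suminf\<close> carries no
  information for a divergent series. \<open>Suc k\<close> and \<open>Suc j\<close> make the indices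
  start at 1.\<close>

theorem mainTheorem7:
  fixes x :: complex
  assumes "Re x > 0"
  shows "summable (\<lambda>k. lerch_Phi (-1) 1 (2 ^ Suc k * x + 1)) \<and>
         Digamma (x + 1) = Ln x + (\<Sum>k. lerch_Phi (-1) 1 (2 ^ Suc k * x + 1)) \<and>
         (\<forall>k. summable (\<lambda>j. fact (Suc j - 1) /
                (2 ^ Suc j * pochhammer (2 ^ Suc k * x + 1) (Suc j)))) \<and>
         summable (\<lambda>k. \<Sum>j. fact (Suc j - 1) /
                (2 ^ Suc j * pochhammer (2 ^ Suc k * x + 1) (Suc j))) \<and>
         Digamma (x + 1) = Ln x + (\<Sum>k. \<Sum>j. fact (Suc j - 1) /
                (2 ^ Suc j * pochhammer (2 ^ Suc k * x + 1) (Suc j)))"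
proof -
  have "Re (2 ^ k * x) = 2 ^ k * Re x" for k
    by (induction k) auto
  hence "Re (2 ^ Suc k * x + 1) > 0" for k
    using assms by (simp add: add_pos_pos del: power_Suc)
  note euler = lerch_Phi_minus1_1_Euler_transform[OF this]
  have inner: "(\<Sum>j. fact (Suc j - 1) / (2 ^ Suc j * pochhammer (2 ^ Suc k * x + 1) (Suc j)))
                 = lerch_Phi (-1) 1 (2 ^ Suc k * x + 1)" for k
    using euler[of k] by (rule sums_unique[symmetric])
  note outer = Digamma_eq_Ln_plus_lerch_sums[OF assms]
  have total: "Digamma (x + 1) = Ln x + (\<Sum>k. lerch_Phi (-1) 1 (2 ^ Suc k * x + 1))"
    using sums_unique[OF outer] by (simp add: algebra_simps)
  show ?thesis
    unfolding inner using sums_summable[OF outer] total sums_summable[OF euler] by blast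
qed

end
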